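(* Let $\mathbb{X}$ and $\mathbb{A}$ be Borel spaces, let $A:\mathbb{X}\to 2^{\mathbb{A}}$ be a strict set-valued map such that its graph ${\rm Gr}(A)$ is Borel, and let $u:{\rm Gr}(A)\to \overline{\mathbb{R}}$ be a Borel measurable function such that $u(x,\,\cdot\,)$ is inf-compact on $A(x)$ for each $x\in\mathbb{X}$. Let $v(x):=\inf_{a\in A(x)}u(x,a)$, $x\in\mathbb{X}$. Then ${\rm dom}(v)\in\mathcal{B}(\mathbb{X})$, and there exists a Borel measurable selector $\varphi:{\rm dom}(v)\to\mathbb{A}$ for $A$ (that is, a Borel measurable mapping with $\varphi(x)\in A(x)$ for all $x\in{\rm dom}(v)$) such that $u(x,\varphi(x))=v(x)$ for all $x\in{\rm dom}(v)$. Moreover, the value function $v$ is Borel measurable on $\mathbb{X}$.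
   Context: A Borel space is a measurable (Borel) subset of a Polish (complete, separable, metric) space, considered with the inherited metric; $\mathcal{B}(\cdot)$ denotes its Borel $\sigma$-algebra. $\overline{\mathbb{R}}=\mathbb{R}\cup\{+\infty\}$. A set-valued map $A:\mathbb{X}\to 2^{\mathbb{A}}$ is strict if $A(x)\neq\emptyset$ for each $x\in\mathbb{X}$; its graph is ${\rm Gr}(A)=\{(x,a)\in\mathbb{X}\times\mathbb{A}: a\in A(x)\}$. A function $f:E\to\overline{\mathbb{R}}$ on a subset $E$ of a metric space is inf-compact on $E$ if the set $\{e\in E: f(e)\le\lambda\}$ is compact for every $\lambda\in\mathbb{R}$. ${\rm dom}(f)=\{e: f(e)<+\infty\}$. *)

theory Defs
  imports "HOL-Analysis.Analysis"
begin

text \<open>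
  A Borel space is a set \<open>S \<in> sets borel\<close> in a type of class \<open>polish_space\<close>. Its Borel
  sigma-algebra is that of \<open>restrict_space borel S\<close>, which is generated by the relatively
  open subsets of \<open>S\<close>.
\<close>

abbreviation borel_on :: "'a::topological_space set \<Rightarrow> 'a measure"
  where "borel_on S \<equiv> restrict_space borel S"

definition strict_on :: "'x set \<Rightarrow> ('x \<Rightarrow> 'a set) \<Rightarrow> bool"
  where "strict_on X A \<longleftrightarrow> (\<forall>x\<in>X. A x \<noteq> {})"

definition Gr :: "'x set \<Rightarrow> ('x \<Rightarrow> 'a set) \<Rightarrow> ('x \<times> 'a) set"
  where "Gr X A = {(x, a). x \<in> X \<and> a \<in> A x}"

text \<open>
  Functions into the reals with \<open>+\<infinity>\<close> adjoined are \<^typ>\<open>ereal\<close>-valued functions that avoid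
  \<open>-\<infinity>\<close> on their domain. The levels below are real, so the set where \<open>f = +\<infinity>\<close> is
  never required to be compact.
\<close>

definition inf_compact_on :: "'a::topological_space set \<Rightarrow> ('a \<Rightarrow> ereal) \<Rightarrow> bool"
  where "inf_compact_on E f \<longleftrightarrow> (\<forall>l::real. compact {e \<in> E. f e \<le> ereal l})"

definition dom_on :: "'a set \<Rightarrow> ('a \<Rightarrow> ereal) \<Rightarrow> 'a set"
  where "dom_on E f = {e \<in> E. f e < \<infinity>}"

definition value_fun :: "('x \<Rightarrow> 'a set) \<Rightarrow> ('x \<times> 'a \<Rightarrow> ereal) \<Rightarrow> 'x \<Rightarrow> ereal"
  where "value_fun A u x = (INF a\<in>A x. u (x, a))"

end

theory Submission
  imports Defs
begin

text \<open>
  Everything rests on the theorem that a Borel set in a product of Polish spaces has a Borel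
  projection if all its sections are compact (\<open>borel_projection_compact_sections\<close>). Projections
  of Borel sets are in general only analytic; compactness of the sections is what makes the
  emptiness of a section witnessed by finitely many conditions, each of which can be chosen
  to be Borel. These choices come from Novikov's separation theorem
  (\<open>Novikov_separation\<close>): countably many analytic sets without a common point have Borel
  supersets without a common point. Equivalently, countable covers by coanalytic sets refine
  to Borel covers (\<open>borel_cover_refinement\<close>).

  Given the projection theorem, the set where the infimum of \<open>u\<close> is below \<open>c\<close> is a countable
  union of projections of sublevel sets of \<open>u\<close>, whose sections are compact by
  inf-compactness. Hence the value function is Borel and its domain is a Borel set. The
  infimum is attained wherever it is finite, and the minimizers form a Borel set with compact sections which
  projects onto the domain of the value function. It remains to select from such a set
  in a Borel way (\<open>borel_selection_compact_sections\<close>). This again is a matter of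
  minimization: minimizing the distances to the points of a dense sequence, one after the other,
  singles out exactly one point in each section.
\<close>

section \<open>Borel sets are analytic\<close>

text \<open>
  The Baire space is a closed subset of the Polish space of real sequences, so sequences
  of reals parametrize the same class of projections as sequences of naturals. Fixing one
  parameter space for all sets makes countable operations expressible on the parameters.
\<close>

definition analytic_set :: "'p::topological_space set \<Rightarrow> bool"
  where "analytic_set B \<longleftrightarrow> (\<exists>C :: ('p \<times> (nat \<Rightarrow> real)) set. closed C \<and> B = fst ` C)"

lemma closed_imp_analytic_set: "closed B \<Longrightarrow> analytic_set B"
  unfolding analytic_set_def
  by (rule exI[of _ "B \<times> UNIV"]) (auto simp: closed_Times)

text \<open>
  The first coordinate of the parameter names the member of the family, and the remaining
  coordinates are the parameter for that member.
\<close>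

lemma analytic_set_UN:
  fixes B :: "nat \<Rightarrow> 'p::topological_space set"
  assumes "\<And>i. analytic_set (B i)"
  shows "analytic_set (\<Union>i. B i)"
proof -
  have "\<forall>i. \<exists>C :: ('p \<times> (nat \<Rightarrow> real)) set. closed C \<and> B i = fst ` C"
    using assms unfolding analytic_set_def by simp
  from choice[OF this] obtain C :: "nat \<Rightarrow> ('p \<times> (nat \<Rightarrow> real)) set"
    where "\<forall>i. closed (C i) \<and> B i = fst ` C i" ..
  then have C: "\<And>i. closed (C i)" "\<And>i. B i = fst ` C i"
    by auto
  \<comment> \<open>Writing membership as "for every \<open>k\<close>, the name is at distance at least one from \<open>k\<close>, or the tail
    works for \<open>k\<close>" presents the union over names as an intersection of closed sets.\<close>
  define D where "D = {z. snd z 0 \<in> (\<nat>::real set)} \<inter>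
    (\<Inter>k. {z. \<bar>snd z 0 - real k\<bar> \<ge> 1} \<union> (\<lambda>z. (fst z, \<lambda>n. snd z (Suc n))) -` C k)"
  have *: "continuous_on UNIV (\<lambda>z::'p \<times> (nat \<Rightarrow> real). snd z n)" for n
    by (rule continuous_on_product_then_coordinatewise) (intro continuous_intros)
  have "closed ((\<lambda>z::'p \<times> (nat \<Rightarrow> real). snd z 0) -` \<nat>)"
    by (intro closed_vimage *) simp
  moreover have "closed ((\<lambda>z. (fst z, \<lambda>n. snd z (Suc n))) -` C k)" for k
    by (intro closed_vimage C continuous_on_Pair continuous_on_fst continuous_on_id
        continuous_on_coordinatewise_then_product *)
  moreover have "closed {z::'p \<times> (nat \<Rightarrow> real). \<bar>snd z 0 - real k\<bar> \<ge> 1}" for k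
    by (intro closed_Collect_le continuous_intros *)
  ultimately have "closed D"
    unfolding D_def vimage_def by (intro closed_Int closed_INT closed_Un) auto
  moreover have "(\<Union>i. B i) = fst ` D"
  proof (intro equalityI subsetI)
    fix x assume "x \<in> (\<Union>i. B i)"
    then obtain i g where "(x, g) \<in> C i"
      using C(2) by fastforce
    then have "(x, case_nat (real i) g) \<in> D"
    proof -
      have "1 \<le> \<bar>real i - real k\<bar> \<or> (x, g) \<in> C k" for k
        using \<open>(x, g) \<in> C i\<close> by (cases "k = i") (simp_all, linarith)
      then show ?thesis
        unfolding D_def by auto
    qed
    then show "x \<in> fst ` D" by force
  next
    fix x assume "x \<in> fst ` D"
    then obtain g where "(x, g) \<in> D" by auto
    then obtain k where "g 0 = real k" by (auto simp: D_def elim: Nats_cases)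
    then have "(x, \<lambda>n. g (Suc n)) \<in> C k"
      using \<open>(x, g) \<in> D\<close> by (force simp: D_def)
    then show "x \<in> (\<Union>i. B i)" using C(2) by force
  qed
  ultimately show ?thesis unfolding analytic_set_def by blast
qed

text \<open>
  One sequence is split by the pairing function into a parameter for each member of the
  family; a common point needs all of them at once, which is a closed condition.
\<close>

lemma analytic_set_INT:
  fixes B :: "nat \<Rightarrow> 'p::topological_space set"
  assumes "\<And>i. analytic_set (B i)"
  shows "analytic_set (\<Inter>i. B i)"
proof -
  have "\<forall>i. \<exists>C :: ('p \<times> (nat \<Rightarrow> real)) set. closed C \<and> B i = fst ` C"
    using assms unfolding analytic_set_def by simp
  from choice[OF this] obtain C :: "nat \<Rightarrow> ('p \<times> (nat \<Rightarrow> real)) set"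
    where "\<forall>i. closed (C i) \<and> B i = fst ` C i" ..
  then have C: "\<And>i. closed (C i)" "\<And>i. B i = fst ` C i"
    by auto
  define D where "D = (\<Inter>i. (\<lambda>z. (fst z, \<lambda>n. snd z (prod_encode (i, n)))) -` C i)"
  have *: "continuous_on UNIV (\<lambda>z::'p \<times> (nat \<Rightarrow> real). snd z n)" for n
    by (rule continuous_on_product_then_coordinatewise) (intro continuous_intros)
  have "closed D" unfolding D_def
    by (intro closed_INT ballI closed_vimage C continuous_on_Pair continuous_on_fst
        continuous_on_id continuous_on_coordinatewise_then_product *)
  moreover have "(\<Inter>i. B i) = fst ` D"
  proof (intro equalityI subsetI)
    fix x assume "x \<in> (\<Inter>i. B i)"
    then have "\<forall>i. \<exists>g. (x, g) \<in> C i"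
      using C(2) by fastforce
    then obtain G where "\<And>i. (x, G i) \<in> C i" by metis
    then have "(x, \<lambda>m. case prod_decode m of (i, n) \<Rightarrow> G i n) \<in> D"
      unfolding D_def by auto
    then show "x \<in> fst ` D" by force
  qed (force simp: C(2) D_def)
  ultimately show ?thesis unfolding analytic_set_def by blast
qed

lemma open_imp_analytic_set:
  fixes B :: "'p::metric_space set"
  assumes "open B"
  shows "analytic_set B"
proof -
  \<comment> \<open>\<open>setdist\<close> to the empty set is zero, so the whole space has to be added separately.\<close>
  have "B = (\<Union>n. {x. setdist {x} (- B) \<ge> 1 / Suc n} \<union> (if B = UNIV then UNIV else {}))"
  proof (cases "B = UNIV")
    case False
    have "(\<exists>n. setdist {x} (- B) \<ge> 1 / Suc n) \<longleftrightarrow> x \<in> B" for x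
    proof -
      have "x \<in> B \<longleftrightarrow> setdist {x} (- B) > 0"
        using assms False setdist_gt_0_compact_closed[of "{x}" "- B"]
        by (auto simp: closed_Compl)
      also have "\<dots> \<longleftrightarrow> (\<exists>n. setdist {x} (- B) \<ge> 1 / Suc n)"
      proof
        assume "setdist {x} (- B) > 0"
        then show "\<exists>n. setdist {x} (- B) \<ge> 1 / Suc n"
          by (meson nat_approx_posE less_imp_le)
      next
        assume "\<exists>n. setdist {x} (- B) \<ge> 1 / Suc n"
        then obtain n where "setdist {x} (- B) \<ge> 1 / Suc n" ..
        moreover have "1 / real (Suc n) > 0" by simp
        ultimately show "setdist {x} (- B) > 0" by linarith
      qed
      finally show ?thesis by simp
    qed
    with False show ?thesis by auto
  qed auto
  moreover have "closed {x. setdist {x} (- B) \<ge> 1 / Suc n}" for n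
    by (intro closed_Collect_le continuous_intros continuous_on_setdist)
  moreover have "closed (if B = UNIV then UNIV else {})" by simp
  ultimately show ?thesis
    using analytic_set_UN[of "\<lambda>n. {x. setdist {x} (- B) \<ge> 1 / Suc n} \<union> (if B = UNIV then UNIV else {})"]
    by (simp add: closed_imp_analytic_set closed_Un)
qed

text \<open>
  The analytic sets are not closed under complement, so the induction along the generation
  of the Borel sets carries a set together with its complement.
\<close>

lemma borel_imp_analytic_set:
  fixes B :: "'p::metric_space set"
  assumes "B \<in> sets borel"
  shows "analytic_set B"
proof -
  have "B \<in> sigma_sets UNIV {S. closed S}"
    using assms by (simp add: borel_eq_closed)
  then have "analytic_set B \<and> analytic_set (- B)"
  proof induction
    case (Basic S)
    then show ?case
      by (simp add: closed_imp_analytic_set open_imp_analytic_set open_Compl)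
  next
    case (Union S)
    then show ?case
      using analytic_set_UN[of S] analytic_set_INT[of "\<lambda>i. - S i"] by simp
  qed (auto simp: closed_imp_analytic_set Compl_eq_Diff_UNIV[symmetric])
  then show ?thesis ..
qed

section \<open>Novikov's separation theorem\<close>

definition borel_separable :: "(nat \<Rightarrow> 'b::topological_space set) \<Rightarrow> bool"
  where "borel_separable S \<longleftrightarrow>
    (\<exists>B. (\<forall>i. B i \<in> sets borel \<and> S i \<subseteq> B i) \<and> (\<Inter>i. B i) = {})"

text \<open>
  If no piece \<open>T k\<close> keeps the sequence inseparable, then the separating families of the pieces
  combine: unite them in coordinate \<open>i\<close> and intersect them in all others. Read
  contrapositively, an inseparable sequence stays inseparable after one of its members is
  replaced by a suitable piece of it.
\<close>

lemma borel_separable_split: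
  assumes cover: "S i \<subseteq> (\<Union>k::nat. T k)"
    and sep: "\<And>k. borel_separable (S(i := T k))"
  shows "borel_separable S"
proof -
  have "\<forall>k. \<exists>B. (\<forall>j. B j \<in> sets borel \<and> (S(i := T k)) j \<subseteq> B j) \<and> (\<Inter>j. B j) = {}"
    using sep unfolding borel_separable_def by simp
  from choice[OF this] obtain B where
    "\<forall>k. (\<forall>j. B k j \<in> sets borel \<and> (S(i := T k)) j \<subseteq> B k j) \<and> (\<Inter>j. B k j) = {}" ..
  then have B: "\<And>k j. B k j \<in> sets borel" "\<And>k j. (S(i := T k)) j \<subseteq> B k j"
    "\<And>k. (\<Inter>j. B k j) = {}"
    by auto
  define B' where "B' j = (if j = i then \<Union>k. B k i else \<Inter>k. B k j)" for j
  have "B' j \<in> sets borel" for j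
    using B(1) by (auto simp: B'_def)
  moreover have "S j \<subseteq> B' j" for j
  proof (cases "j = i")
    case True
    have "T k \<subseteq> B k i" for k using B(2)[of k i] by simp
    then have "(\<Union>k. T k) \<subseteq> (\<Union>k. B k i)" by blast
    then show ?thesis using True cover by (simp add: B'_def)
  next
    case False
    have "S j \<subseteq> B k j" for k using B(2)[of k j] False by simp
    then show ?thesis using False by (auto simp: B'_def)
  qed
  moreover have False if x: "\<forall>j. x \<in> B' j" for x
  proof -
    obtain k where k: "x \<in> B k i" using spec[OF x, of i] by (auto simp: B'_def)
    have "x \<in> B k j" for j using k spec[OF x, of j] by (auto simp: B'_def split: if_splits)
    then show False using B(3)[of k] by auto
  qed
  ultimately have "(\<forall>j. B' j \<in> sets borel \<and> S j \<subseteq> B' j) \<and> (\<Inter>j. B' j) = {}"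
    by auto
  then show ?thesis unfolding borel_separable_def by (rule exI[of _ B'])
qed

lemma countable_ball_cover:
  fixes r :: real
  assumes "r > 0"
  obtains e :: "nat \<Rightarrow> 'p::{metric_space, second_countable_topology}" where "(\<Union>k. ball (e k) r) = UNIV"
proof -
  obtain D :: "'p set" where D: "countable D" "\<And>U. open U \<Longrightarrow> U \<noteq> {} \<Longrightarrow> \<exists>d\<in>D. d \<in> U"
    using countable_dense_setE by blast
  have "\<exists>k. x \<in> ball (from_nat_into D k) r" for x
  proof -
    obtain d where "d \<in> D" "d \<in> ball x r" using D(2)[of "ball x r"] assms by auto
    then show ?thesis
      by (metis D(1) dist_commute from_nat_into_surj mem_ball)
  qed
  then show ?thesis by (intro that[of "from_nat_into D"]) auto
qed

text \<open>
  Suppose the images are inseparable. Step \<open>n\<close>, decoded as a pair \<open>(i, j)\<close>, cuts the \<open>i\<close>-th set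
  down to a ball of radius \<open>(1/2)^j\<close> while keeping the images inseparable; every index
  \<open>i\<close> is treated infinitely often. The closed sets of each index therefore shrink to a point
  \<open>p i\<close> of \<open>C i\<close>. The images of these points cannot all agree, because the images of the
  \<open>C i\<close> have no common point. Two different images have disjoint open neighbourhoods,
  and these separate two of the members at a late stage, hence the whole sequence.

  The sort of complete second countable metric types is that of \<open>polish_space\<close>; spelled out as
  an intersection of classes, it is visibly inherited by products.
\<close>

lemma Novikov_separation_closed:
  fixes C :: "nat \<Rightarrow> 'p::{complete_space, second_countable_topology} set"
    and f :: "'p \<Rightarrow> 'b::t2_space"
  assumes closed: "\<And>i. closed (C i)"
    and f: "continuous_on UNIV f"
    and disj: "(\<Inter>i. f ` C i) = {}"
  shows "borel_separable (\<lambda>i. f ` C i)"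
proof (rule ccontr)
  assume nonsep: "\<not> borel_separable (\<lambda>i. f ` C i)"
  define step where "step n X Y \<longleftrightarrow>
    (\<exists>e. Y = (case prod_decode n of (i, j) \<Rightarrow> X(i := X i \<inter> cball e ((1/2)^j))))"
    for n and X Y :: "nat \<Rightarrow> 'p set"
  \<comment> \<open>The balls of the given radius around a countable dense set cover the space, so one of the
    pieces must preserve inseparability.\<close>
  have "\<exists>Y. \<not> borel_separable (\<lambda>i. f ` Y i) \<and> step n X Y"
    if X: "\<not> borel_separable (\<lambda>i. f ` X i)" for n X
  proof -
    obtain i j where ij: "prod_decode n = (i, j)" by fastforce
    obtain e :: "nat \<Rightarrow> 'p" where "(\<Union>k. ball (e k) ((1/2)^j)) = UNIV"
      using countable_ball_cover[of "(1/2)^j"] by auto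
    moreover have "(\<Union>k. ball (e k) ((1/2)^j)) \<subseteq> (\<Union>k. cball (e k) ((1/2)^j))"
      by (intro UN_mono ball_subset_cball order_refl)
    ultimately have e: "(\<Union>k. cball (e k) ((1/2)^j)) = UNIV"
      by (simp add: top.extremum_unique)
    have "f ` X i \<subseteq> (\<Union>k. f ` (X i \<inter> cball (e k) ((1/2)^j)))"
      using e by blast
    then obtain k where k: "\<not> borel_separable ((\<lambda>i. f ` X i)(i := f ` (X i \<inter> cball (e k) ((1/2)^j))))"
      using X borel_separable_split[of "\<lambda>i. f ` X i"] by blast
    have "(\<lambda>i. f ` X i)(i := f ` Z) = (\<lambda>l. f ` (X(i := Z)) l)" for Z
      by (rule ext) simp
    with k have "\<not> borel_separable (\<lambda>l. f ` (X(i := X i \<inter> cball (e k) ((1/2)^j))) l)"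
      by metis
    then show ?thesis
      unfolding step_def ij prod.case by blast
  qed
  then have "\<exists>X. \<forall>n. (\<not> borel_separable (\<lambda>i. f ` X n i) \<and> (n = 0 \<longrightarrow> X n = C)) \<and> step n (X n) (X (Suc n))"
    using nonsep by (intro dependent_nat_choice) auto
  then obtain X where X: "\<And>n. \<not> borel_separable (\<lambda>i. f ` X n i)" "X 0 = C"
      "\<And>n. step n (X n) (X (Suc n))"
    by blast
  have stepX: "\<exists>e. X (Suc (prod_encode (i, j))) =
      (X (prod_encode (i, j)))(i := X (prod_encode (i, j)) i \<inter> cball e ((1/2)^j))" for i j
    using X(3)[of "prod_encode (i, j)"] by (simp add: step_def)
  have SucX: "\<exists>D. closed D \<and> X (Suc n) i = X n i \<inter> D" for n i
  proof -
    obtain i' j where n: "n = prod_encode (i', j)"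
      by (metis prod_decode_inverse surj_pair)
    obtain e where e: "X (Suc n) = (X n)(i' := X n i' \<inter> cball e ((1/2)^j))"
      using stepX[of i' j] n by blast
    show ?thesis
      by (rule exI[of _ "if i = i' then cball e ((1/2)^j) else UNIV"]) (simp add: e)
  qed
  have closedX: "closed (X n i)" for n i
  proof (induction n)
    case 0
    then show ?case using X(2) closed by simp
  next
    case (Suc n)
    then show ?case using SucX[of n i] by auto
  qed
  have decX: "X n i \<subseteq> X m i" if "m \<le> n" for m n i
    using lift_Suc_antimono_le[of "\<lambda>n. X n i"] SucX that by (metis Int_lower1)
  have small: "\<exists>e. X (Suc (prod_encode (i, j))) i \<subseteq> cball e ((1/2)^j)" for i j
  proof -
    obtain e where "X (Suc (prod_encode (i, j))) =
        (X (prod_encode (i, j)))(i := X (prod_encode (i, j)) i \<inter> cball e ((1/2)^j))"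
      using stepX by blast
    then show ?thesis by (intro exI[of _ e]) simp
  qed
  have nonempty: "X n i \<noteq> {}" for n i
  proof
    assume "X n i = {}"
    then have "borel_separable (\<lambda>i. f ` X n i)"
      unfolding borel_separable_def
      by (intro exI[of _ "(\<lambda>_. UNIV)(i := {})"]) auto
    with X(1) show False by blast
  qed
  have diam: "\<exists>n. \<forall>x\<in>X n i. \<forall>y\<in>X n i. dist x y < r" if "r > 0" for r i
  proof -
    obtain j where j: "(1/2::real)^j < r / 2"
      using real_arch_pow_inv[of "r/2" "1/2"] \<open>r > 0\<close> by auto
    obtain e where e: "X (Suc (prod_encode (i, j))) i \<subseteq> cball e ((1/2)^j)"
      using small by blast
    have "dist x y < r" if "x \<in> X (Suc (prod_encode (i, j))) i" "y \<in> X (Suc (prod_encode (i, j))) i" for x y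
    proof -
      have "dist e x \<le> (1/2)^j" "dist e y \<le> (1/2)^j" using e that by auto
      then show ?thesis using dist_triangle3[of x y e] j by simp
    qed
    then show ?thesis by blast
  qed
  have "\<exists>p. \<forall>n. p \<in> X n i" for i
    using decreasing_closed_nest[of "\<lambda>n. X n i"] closedX nonempty decX diam by metis
  then obtain p where p: "\<And>n i. p i \<in> X n i" by metis
  have nbhd: "\<exists>n. f ` X n i \<subseteq> U" if "open U" "f (p i) \<in> U" for U i
  proof -
    have "open (f -` U)" using f \<open>open U\<close> by (simp add: open_vimage)
    then obtain r where r: "r > 0" "ball (p i) r \<subseteq> f -` U"
      using \<open>f (p i) \<in> U\<close> by (meson open_contains_ball vimageI)
    then obtain n where "\<forall>y\<in>X n i. dist (p i) y < r" using diam p by metis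
    then have "X n i \<subseteq> f -` U" using r by (auto simp: subset_iff)
    then show ?thesis by blast
  qed
  have "f (p i) \<in> f ` C i" for i using p[of i 0] X(2) by auto
  then obtain i where i: "f (p i) \<noteq> f (p 0)"
    using disj by (metis INT_I empty_iff UNIV_I)
  then obtain U V where UV: "open U" "open V" "f (p i) \<in> U" "f (p 0) \<in> V" "U \<inter> V = {}"
    by (meson hausdorff)
  obtain m n where "f ` X m i \<subseteq> U" "f ` X n 0 \<subseteq> V" using nbhd UV by metis
  then have "f ` X (max m n) i \<subseteq> U" "f ` X (max m n) 0 \<subseteq> V"
    using image_mono[OF decX[of m "max m n" i], of f] image_mono[OF decX[of n "max m n" 0], of f]
    by simp_all
  moreover have "i \<noteq> 0" using i by metis
  ultimately have "borel_separable (\<lambda>i. f ` X (max m n) i)"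
    unfolding borel_separable_def
    using UV by (intro exI[of _ "(\<lambda>_. UNIV)(i := U, 0 := V)"]) (auto dest: spec[of _ i])
  with X(1) show False by blast
qed

text \<open>
  A Borel set is the projection of a closed set, so its image under \<open>f\<close> is the image of a closed
  set under \<open>f\<close> composed with the projection.
\<close>

lemma Novikov_separation:
  fixes B :: "nat \<Rightarrow> 'p::{complete_space, second_countable_topology} set"
    and f :: "'p \<Rightarrow> 'b::t2_space"
  assumes B: "\<And>i. B i \<in> sets borel"
    and f: "continuous_on UNIV f"
    and disj: "(\<Inter>i. f ` B i) = {}"
  shows "borel_separable (\<lambda>i. f ` B i)"
proof -
  have "\<forall>i. \<exists>C :: ('p \<times> (nat \<Rightarrow> real)) set. closed C \<and> B i = fst ` C"
    using borel_imp_analytic_set[OF B] unfolding analytic_set_def by simp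
  from choice[OF this] obtain C :: "nat \<Rightarrow> ('p \<times> (nat \<Rightarrow> real)) set"
    where "\<forall>i. closed (C i) \<and> B i = fst ` C i" ..
  then have C: "\<And>i. closed (C i)" "\<And>i. B i = fst ` C i"
    by auto
  have eq: "f ` B i = (\<lambda>z. f (fst z)) ` C i" for i
    by (simp add: C(2) image_image)
  show ?thesis
    unfolding eq
    using disj C(1) unfolding eq
    by (intro Novikov_separation_closed continuous_on_compose2[OF f] continuous_intros) auto
qed

text \<open>
  Complementary form of the separation theorem: a countable cover by coanalytic sets can be
  shrunk to a cover by Borel sets. This is how countably many choices depending on a point
  are turned into Borel choices below.
\<close>

lemma borel_cover_refinement:
  fixes B :: "nat \<Rightarrow> 'p::{complete_space, second_countable_topology} set"
    and f :: "'p \<Rightarrow> 'b::t2_space"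
  assumes B: "\<And>i. B i \<in> sets borel"
    and f: "continuous_on UNIV f"
    and cover: "(\<Union>i. - f ` B i) = UNIV"
  obtains T where "\<And>i. T i \<in> sets borel" "\<And>i. T i \<subseteq> - f ` B i" "(\<Union>i. T i) = UNIV"
proof -
  have "(\<Inter>i. f ` B i) = {}"
    using cover by blast
  then have "borel_separable (\<lambda>i. f ` B i)"
    using B f by (intro Novikov_separation) auto
  then obtain S where S: "\<And>i. S i \<in> sets borel" "\<And>i. f ` B i \<subseteq> S i" "(\<Inter>i. S i) = {}"
    unfolding borel_separable_def by blast
  show ?thesis
  proof (rule that[of "\<lambda>i. - S i"])
    show "- S i \<in> sets borel" for i
      using S(1) by (rule borel_comp)
    show "- S i \<subseteq> - f ` B i" for i
      using S(2)[of i] by blast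
    show "(\<Union>i. - S i) = UNIV"
      using S(3) by blast
  qed
qed

text \<open>
  The case of two sets, obtained by repeating the second one infinitely often.
\<close>

lemma Lusin_separation:
  fixes B1 B2 :: "'p::{complete_space, second_countable_topology} set"
    and f :: "'p \<Rightarrow> 'b::t2_space"
  assumes "B1 \<in> sets borel" "B2 \<in> sets borel"
    and f: "continuous_on UNIV f"
    and disj: "f ` B1 \<inter> f ` B2 = {}"
  obtains S where "S \<in> sets borel" "f ` B1 \<subseteq> S" "S \<inter> f ` B2 = {}"
proof -
  let ?B = "\<lambda>i::nat. if i = 0 then B1 else B2"
  have "(\<Inter>i. f ` ?B i) \<subseteq> f ` ?B 0 \<inter> f ` ?B 1"
    by blast
  then have "(\<Inter>i. f ` ?B i) = {}"
    using disj by simp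
  then have "borel_separable (\<lambda>i. f ` ?B i)"
    using assms by (intro Novikov_separation) auto
  then obtain S where S: "\<And>i. S i \<in> sets borel" "\<And>i. f ` ?B i \<subseteq> S i" "(\<Inter>i. S i) = {}"
    unfolding borel_separable_def by blast
  show ?thesis
  proof (rule that[of "S 0"])
    show "f ` B1 \<subseteq> S 0" using S(2)[of 0] by simp
    show "S 0 \<inter> f ` B2 = {}"
    proof -
      have "f ` B2 \<subseteq> S (Suc i)" for i using S(2)[of "Suc i"] by simp
      then have "S 0 \<inter> f ` B2 \<subseteq> S i" for i by (cases i) auto
      then show ?thesis using S(3) by blast
    qed
  qed (rule S)
qed

lemma borel_vimage_continuous:
  assumes "B \<in> sets borel" "continuous_on UNIV f"
  shows "f -` B \<in> sets borel"
  using measurable_sets_borel[OF borel_measurable_continuous_onI[OF assms(2)] assms(1)] .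

section \<open>Projections of Borel sets with compact sections\<close>

text \<open>
  Kunugui--Novikov theorem for the complement of \<open>E\<close>, whose sections are open. Let \<open>C m\<close> be the
  coanalytic set of those \<open>x\<close> for which \<open>V m\<close> misses the section of \<open>E\<close> at \<open>x\<close>. The rectangles
  \<open>C m \<times> V m\<close> cover the complement of \<open>E\<close>, but \<open>C m\<close> need not be Borel. Shrinking the coanalytic
  cover by the sets \<open>E \<union> C m \<times> V m\<close> to a Borel cover \<open>T m\<close>, the projection of \<open>T m - E\<close> is an
  analytic subset of \<open>C m\<close>, and a Borel set between the two can take the place of \<open>C m\<close>.
\<close>

lemma borel_open_sections_rectangles:
  fixes E :: "('x::{complete_space, second_countable_topology} \<times>
      'a::{complete_space, second_countable_topology}) set"
    and V :: "nat \<Rightarrow> 'a set"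
  assumes E: "E \<in> sets borel"
    and closed: "\<And>x. closed {a. (x, a) \<in> E}"
    and V: "\<And>m. open (V m)" "\<And>U a. open U \<Longrightarrow> a \<in> U \<Longrightarrow> \<exists>m. a \<in> V m \<and> V m \<subseteq> U"
  obtains S where "\<And>m. S m \<in> sets borel" "- E = (\<Union>m. S m \<times> V m)"
proof -
  \<comment> \<open>The projection of \<open>H m\<close> is the complement of \<open>E \<union> C m \<times> V m\<close>: over a point
    whose second coordinate is in \<open>V m\<close>, the additional coordinate is a witness that \<open>V m\<close> meets the
    section of \<open>E\<close>.\<close>
  define H :: "nat \<Rightarrow> (('x \<times> 'a) \<times> 'a) set" where
    "H m = {z. fst z \<notin> E \<and> (snd (fst z) \<notin> V m \<or> (fst (fst z), snd z) \<in> E \<and> snd z \<in> V m)}" for m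
  have H: "H m \<in> sets borel" for m
  proof -
    have "H m = fst -` (- E) \<inter> ((\<lambda>z. snd (fst z)) -` (- V m)
        \<union> (\<lambda>z. (fst (fst z), snd z)) -` E \<inter> snd -` V m)"
      by (auto simp: H_def)
    moreover have "V m \<in> sets borel" "- V m \<in> sets borel"
      using V(1) by (simp_all add: borel_comp)
    ultimately show ?thesis
      using E by (simp only:) (intro sets.Int sets.Un borel_vimage_continuous borel_comp
          continuous_on_Pair continuous_on_fst continuous_on_snd continuous_on_id)
  qed
  have H_iff: "(x, a) \<in> - fst ` H m \<longleftrightarrow>
      (x, a) \<in> E \<or> (a \<in> V m \<and> (\<forall>b\<in>V m. (x, b) \<notin> E))" for x a m
  proof -
    have "(x, a) \<in> fst ` H m \<longleftrightarrow> (\<exists>b. ((x, a), b) \<in> H m)" by force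
    then show ?thesis by (auto simp: H_def)
  qed
  have "(\<Union>m. - fst ` H m) = UNIV"
  proof -
    have "\<exists>m. (x, a) \<in> - fst ` H m" for x a
    proof (cases "(x, a) \<in> E")
      case False
      then obtain m where "a \<in> V m" "V m \<subseteq> - {a. (x, a) \<in> E}"
        using V(2)[of "- {a. (x, a) \<in> E}" a] closed[of x] by (auto simp: open_Compl)
      then show ?thesis unfolding H_iff by blast
    qed (simp only: H_iff, simp)
    then show ?thesis by auto
  qed
  then obtain T where T: "\<And>m. T m \<in> sets borel" "\<And>m. T m \<subseteq> - fst ` H m" "(\<Union>m. T m) = UNIV"
    by (rule borel_cover_refinement[OF H continuous_on_fst[OF continuous_on_id]]) (rule that)
  have T_sub: "a \<in> V m \<and> (\<forall>b\<in>V m. (x, b) \<notin> E)" if "(x, a) \<in> T m - E" for x a m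
    using that T(2)[of m] H_iff[of x a m] by blast
  have "\<exists>S. S \<in> sets borel \<and> fst ` (T m - E) \<subseteq> S \<and> S \<inter> fst ` (E \<inter> snd -` V m) = {}" for m
  proof -
    have "T m - E \<in> sets borel"
      using T E by auto
    moreover have "E \<inter> snd -` V m \<in> sets borel"
      using E V(1) by (intro sets.Int borel_vimage_continuous continuous_on_snd continuous_on_id) auto
    moreover have "fst ` (T m - E) \<inter> fst ` (E \<inter> snd -` V m) = {}"
    proof (rule equals0I)
      fix x assume "x \<in> fst ` (T m - E) \<inter> fst ` (E \<inter> snd -` V m)"
      then obtain a b where "(x, a) \<in> T m - E" "(x, b) \<in> E" "b \<in> V m"
        by auto
      then show False using T_sub[of x a m] by blast
    qed
    ultimately obtain S where
      "S \<in> sets borel" "fst ` (T m - E) \<subseteq> S" "S \<inter> fst ` (E \<inter> snd -` V m) = {}"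
      by (rule Lusin_separation[OF _ _ continuous_on_fst[OF continuous_on_id]]) (rule that)
    then show ?thesis by blast
  qed
  then obtain S where S: "\<And>m. S m \<in> sets borel" "\<And>m. fst ` (T m - E) \<subseteq> S m"
    "\<And>m. S m \<inter> fst ` (E \<inter> snd -` V m) = {}"
    by metis
  show ?thesis
  proof (rule that[OF S(1)])
    show "- E = (\<Union>m. S m \<times> V m)"
    proof (intro equalityI subsetI)
      fix z assume "z \<in> - E"
      moreover obtain x a where z: "z = (x, a)" by fastforce
      moreover obtain m where "z \<in> T m" using T(3) by blast
      ultimately have "(x, a) \<in> T m - E" by simp
      then have "a \<in> V m" "x \<in> S m" using T_sub[of x a m] S(2)[of m] by force+
      then show "z \<in> (\<Union>m. S m \<times> V m)" using z by blast
    next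
      fix z assume "z \<in> (\<Union>m. S m \<times> V m)"
      then obtain m x a where z: "z = (x, a)" "x \<in> S m" "a \<in> V m" by blast
      then show "z \<in> - E" using S(3)[of m] by force
    qed
  qed
qed

lemma nat_indexed_basis:
  obtains V :: "nat \<Rightarrow> 'a::second_countable_topology set"
  where "\<And>m. open (V m)" "\<And>U a. open U \<Longrightarrow> a \<in> U \<Longrightarrow> \<exists>m. a \<in> V m \<and> V m \<subseteq> U"
proof -
  obtain B :: "'a set set" where B: "countable B" "topological_basis B"
    using ex_countable_basis by blast
  have "B \<noteq> {}"
    using topological_basisE[OF B(2), of UNIV] by blast
  show ?thesis
  proof (rule that[of "from_nat_into B"])
    show "open (from_nat_into B m)" for m
      using B \<open>B \<noteq> {}\<close> by (simp add: from_nat_into topological_basis_open)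
    show "\<exists>m. a \<in> from_nat_into B m \<and> from_nat_into B m \<subseteq> U" if "open U" "a \<in> U" for U a
      using topological_basisE[OF B(2) that] B(1) \<open>B \<noteq> {}\<close> by (metis from_nat_into_surj)
  qed
qed

lemma totally_bounded_sequence_imp_convergent_subsequence:
  fixes a :: "nat \<Rightarrow> 'a::complete_space"
  assumes "\<And>r. r > 0 \<Longrightarrow> \<exists>K. finite K \<and> range a \<subseteq> (\<Union>c\<in>K. cball c r)"
  obtains l r where "strict_mono (r :: nat \<Rightarrow> nat)" "(a \<circ> r) \<longlonglongrightarrow> l"
proof -
  have "compact (closure (range a))"
    unfolding compact_eq_totally_bounded
  proof (intro conjI allI impI)
    show "complete (closure (range a))"
      by (simp add: complete_eq_closed)
    fix e :: real assume "e > 0"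
    then obtain K where K: "finite K" "range a \<subseteq> (\<Union>c\<in>K. cball c (e/2))"
      using assms[of "e/2"] by auto
    then have "closure (range a) \<subseteq> (\<Union>c\<in>K. cball c (e/2))"
      by (intro closure_minimal closed_UN) auto
    also have "\<dots> \<subseteq> (\<Union>c\<in>K. ball c e)"
      using \<open>e > 0\<close> by (intro UN_mono) auto
    finally show "\<exists>K. finite K \<and> closure (range a) \<subseteq> (\<Union>c\<in>K. ball c e)"
      using K(1) by blast
  qed
  moreover have "\<forall>n. a n \<in> closure (range a)"
    using closure_subset[of "range a"] by auto
  ultimately obtain l r where "strict_mono (r :: nat \<Rightarrow> nat)" "(a \<circ> r) \<longlonglongrightarrow> l"
    unfolding compact_def by blast
  then show ?thesis by (rule that)
qed

text \<open>
  It must be expressed in a Borel way that the section at \<open>x\<close> is empty. With the Borel rectangles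
  \<open>S m \<times> V m\<close> of the complement, this means that the sets \<open>V m\<close> with \<open>x \<in> S m\<close> cover the
  whole second space, and a countable statement requires that finitely many of them
  suffice. The second space need not be compact, but compact sections are totally bounded: the
  set of \<open>x\<close> whose section lies in the first \<open>k\<close> balls of a cover by balls of radius
  \<open>(1/2)^n\<close> is coanalytic, these sets cover for each \<open>n\<close>, and so there are Borel sets
  \<open>W n k\<close> inside them which still cover. It is then enough to cover the intersection of finitely many such unions of balls by
  finitely many \<open>V m\<close>. If this failed at every finite stage, points escaping the stages would
  form a totally bounded sequence, and a limit point of it would lie in some \<open>V m\<close>
  and thus be reached by the sequence again.
\<close>

lemma borel_projection_compact_sections:
  fixes E :: "('x::{complete_space, second_countable_topology} \<times>
      'a::{complete_space, second_countable_topology}) set"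
  assumes E: "E \<in> sets borel"
    and compact: "\<And>x. compact {a. (x, a) \<in> E}"
  shows "fst ` E \<in> sets borel"
proof -
  obtain V :: "nat \<Rightarrow> 'a set"
    where V: "\<And>m. open (V m)" "\<And>U a. open U \<Longrightarrow> a \<in> U \<Longrightarrow> \<exists>m. a \<in> V m \<and> V m \<subseteq> U"
    using nat_indexed_basis by blast
  obtain S where S: "\<And>m. S m \<in> sets borel" "- E = (\<Union>m. S m \<times> V m)"
    using borel_open_sections_rectangles[OF E compact_imp_closed[OF compact] V] by blast
  have "\<exists>e::nat \<Rightarrow> 'a. (\<Union>k. ball (e k) ((1/2)^n)) = UNIV" for n
    using countable_ball_cover[of "(1/2)^n"] by (metis half_gt_zero_iff zero_less_one zero_less_power)
  then obtain e :: "nat \<Rightarrow> nat \<Rightarrow> 'a" where e: "\<And>n. (\<Union>k. ball (e n k) ((1/2)^n)) = UNIV"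
    by metis
  define U where "U n k = (\<Union>j<k. ball (e n j) ((1/2)^n))" for n k
  have "\<exists>W. (\<forall>k. W k \<in> sets borel) \<and> (\<forall>k. W k \<subseteq> {x. \<forall>a. (x, a) \<in> E \<longrightarrow> a \<in> U n k}) \<and> (\<Union>k. W k) = UNIV" for n
  proof -
    have eq: "{x. \<forall>a. (x, a) \<in> E \<longrightarrow> a \<in> U n k} = - fst ` (E \<inter> snd -` (- U n k))" for k
      by force
    have "open (U n k)" for k unfolding U_def by auto
    then have *: "E \<inter> snd -` (- U n k) \<in> sets borel" for k
      using E by (intro sets.Int borel_vimage_continuous borel_comp continuous_on_snd continuous_on_id) auto
    have "\<exists>k. {a. (x, a) \<in> E} \<subseteq> U n k" for x
    proof -
      obtain J where J: "finite J" "{a. (x, a) \<in> E} \<subseteq> (\<Union>j\<in>J. ball (e n j) ((1/2)^n))"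
        using compactE_image[OF compact[of x], of UNIV "\<lambda>j. ball (e n j) ((1/2)^n)"] e[of n] by auto
      obtain k where "J \<subseteq> {..<k}"
        using J(1) finite_nat_iff_bounded by blast
      then have "(\<Union>j\<in>J. ball (e n j) ((1/2)^n)) \<subseteq> U n k"
        unfolding U_def by (rule UN_mono) (rule order_refl)
      with J(2) show ?thesis by (meson order_trans)
    qed
    then have "(\<Union>k. {x. \<forall>a. (x, a) \<in> E \<longrightarrow> a \<in> U n k}) = UNIV"
      by (auto simp: subset_iff)
    then obtain W where "\<And>k. W k \<in> sets borel"
      "\<And>k. W k \<subseteq> - fst ` (E \<inter> snd -` (- U n k))" "(\<Union>k. W k) = UNIV"
      unfolding eq
      by (rule borel_cover_refinement[OF * continuous_on_fst[OF continuous_on_id]]) (rule that)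
    then show ?thesis
      unfolding eq by blast
  qed
  then obtain W where W: "\<And>n k. W n k \<in> sets borel"
    "\<And>n k x a. x \<in> W n k \<Longrightarrow> (x, a) \<in> E \<Longrightarrow> a \<in> U n k" "\<And>n. (\<Union>k. W n k) = UNIV"
    by (metis (mono_tags, lifting) mem_Collect_eq subset_iff)
  \<comment> \<open>A pair of lists \<open>(ks, ms)\<close> in \<open>good\<close> is a finite certificate: where it applies, which is on
    the Borel set \<open>R (ks, ms)\<close>, the section of \<open>E\<close> is empty.\<close>
  define good where "good =
    {(ks, ms). (\<Inter>i<length ks. U i (ks ! i)) \<subseteq> (\<Union>m\<in>set ms. V m)}"
  define R where "R p = (\<Inter>i<length (fst p). W i (fst p ! i)) \<inter> (\<Inter>m\<in>set (snd p). S m)"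
    for p :: "nat list \<times> nat list"
  have "R p \<in> sets borel" for p
    using W(1) S(1) unfolding R_def
    by (intro sets.Int sets.countable_INT'') auto
  then have "(\<Union>p\<in>good. R p) \<in> sets borel"
    by (intro sets.countable_UN'') auto
  moreover have "fst ` E = - (\<Union>p\<in>good. R p)"
  proof (intro equalityI subsetI)
    fix x assume "x \<in> fst ` E"
    then obtain a where a: "(x, a) \<in> E" by auto
    have False if p: "(ks, ms) \<in> good" "x \<in> R (ks, ms)" for ks ms
    proof -
      have "a \<in> (\<Inter>i<length ks. U i (ks ! i))"
        using p(2) W(2)[OF _ a] by (auto simp: R_def)
      then obtain m where "m \<in> set ms" "a \<in> V m" using p(1) by (auto simp: good_def)
      moreover have "x \<in> S m" using p(2) \<open>m \<in> set ms\<close> by (auto simp: R_def)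
      ultimately have "(x, a) \<in> - E" unfolding S(2) by blast
      with a show False by simp
    qed
    then show "x \<in> - (\<Union>p\<in>good. R p)" by auto
  next
    fix x assume x: "x \<in> - (\<Union>p\<in>good. R p)"
    show "x \<in> fst ` E"
    proof (rule ccontr)
      assume notin: "x \<notin> fst ` E"
      have "\<exists>k. x \<in> W n k" for n
        using W(3)[of n] by (metis UNIV_I UN_iff)
      then obtain k where k: "\<And>n. x \<in> W n (k n)" by metis
      have "\<exists>a. (\<forall>i<N. a \<in> U i (k i)) \<and> (\<forall>m<N. x \<in> S m \<longrightarrow> a \<notin> V m)" for N
      proof -
        let ?ks = "map k [0..<N]" and ?ms = "filter (\<lambda>m. x \<in> S m) [0..<N]"
        have "x \<in> R (?ks, ?ms)" using k by (auto simp: R_def)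
        then have "(?ks, ?ms) \<notin> good" using x by auto
        then show ?thesis by (force simp: good_def)
      qed
      then obtain a where a: "\<And>N i. i < N \<Longrightarrow> a N \<in> U i (k i)"
        "\<And>N m. m < N \<Longrightarrow> x \<in> S m \<Longrightarrow> a N \<notin> V m"
        by metis
      have "\<exists>K. finite K \<and> range a \<subseteq> (\<Union>c\<in>K. cball c r)" if "r > 0" for r
      proof -
        obtain i where i: "(1/2::real)^i < r"
          using real_arch_pow_inv[of r "1/2"] \<open>r > 0\<close> by auto
        let ?K = "a ` {..i} \<union> e i ` {..<k i}"
        have "\<exists>c\<in>?K. a N \<in> cball c r" for N
        proof (cases "N \<le> i")
          case True
          then show ?thesis using \<open>r > 0\<close> by (intro bexI[of _ "a N"]) auto
        next
          case False
          then have "a N \<in> U i (k i)" using a(1) by simp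
          then obtain j where "j < k i" "dist (e i j) (a N) < (1/2)^i" by (auto simp: U_def)
          then show ?thesis using i by (intro bexI[of _ "e i j"]) auto
        qed
        then show ?thesis by (intro exI[of _ ?K]) blast
      qed
      then obtain l r where l: "strict_mono (r :: nat \<Rightarrow> nat)" "(a \<circ> r) \<longlonglongrightarrow> l"
        using totally_bounded_sequence_imp_convergent_subsequence[of a] by blast
      have "(x, l) \<in> - E" using notin by (metis ComplI fst_conv image_eqI)
      then obtain m where m: "x \<in> S m" "l \<in> V m" unfolding S(2) by blast
      have "\<forall>\<^sub>F n in sequentially. a (r n) \<in> V m"
        using topological_tendstoD[OF l(2) V(1) m(2)] by simp
      then obtain n0 where "\<And>n. n \<ge> n0 \<Longrightarrow> a (r n) \<in> V m"
        unfolding eventually_sequentially by blast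
      moreover have "m < r (max n0 (Suc m))"
        using seq_suble[OF l(1), of "max n0 (Suc m)"] by linarith
      ultimately show False using a(2)[of m "r (max n0 (Suc m))"] m(1) by auto
    qed
  qed
  ultimately show ?thesis by (metis borel_comp)
qed

section \<open>Minimization over compact sections\<close>

definition sections_inf :: "('x \<times> 'a) set \<Rightarrow> ('x \<times> 'a \<Rightarrow> ereal) \<Rightarrow> 'x \<Rightarrow> ereal"
  where "sections_inf E u x = (INF a\<in>{a. (x, a) \<in> E}. u (x, a))"

text \<open>
  Where the infimum is \<open>\<infinity>\<close>, every point of the section attains it, and the section need not
  be compact; such sections are therefore left out.
\<close>

definition minimizers :: "('x \<times> 'a) set \<Rightarrow> ('x \<times> 'a \<Rightarrow> ereal) \<Rightarrow> ('x \<times> 'a) set"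
  where "minimizers E u =
    {z \<in> E. u z = sections_inf E u (fst z) \<and> sections_inf E u (fst z) < \<infinity>}"

definition borel_compact_sublevels ::
    "('x::topological_space \<times> 'a::topological_space) set \<Rightarrow> ('x \<times> 'a \<Rightarrow> ereal) \<Rightarrow> bool"
  where "borel_compact_sublevels E u \<longleftrightarrow>
    E \<in> sets borel \<and> u \<in> borel_measurable (restrict_space borel E) \<and>
    (\<forall>z\<in>E. u z \<noteq> -\<infinity>) \<and>
    (\<forall>x. \<forall>l::real. compact {a. (x, a) \<in> E \<and> u (x, a) \<le> ereal l})"

text \<open>
  The infimum is below \<open>c\<close> iff some rational sublevel with level below \<open>c\<close> meets the section, so the
  strict sublevels of the infimum are countable unions of projections of Borel sets with
  compact sections.
\<close>

lemma measurable_sections_inf: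
  fixes E :: "('x::{complete_space, second_countable_topology} \<times>
      'a::{complete_space, second_countable_topology}) set"
  assumes "borel_compact_sublevels E u"
  shows "sections_inf E u \<in> borel_measurable borel"
proof -
  have E: "E \<in> sets borel" and u: "u \<in> borel_measurable (restrict_space borel E)"
    and compact: "\<And>x l. compact {a. (x, a) \<in> E \<and> u (x, a) \<le> ereal l}"
    using assms by (auto simp: borel_compact_sublevels_def)
  have sublevel: "fst ` {z \<in> E. u z \<le> ereal l} \<in> sets borel" for l
  proof (rule borel_projection_compact_sections)
    have "u -` {..ereal l} \<inter> space (restrict_space borel E) \<in> sets (restrict_space borel E)"
      using u by (rule measurable_sets) simp
    also have "u -` {..ereal l} \<inter> space (restrict_space borel E) = {z \<in> E. u z \<le> ereal l}"
      by (auto simp: space_restrict_space)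
    finally show "{z \<in> E. u z \<le> ereal l} \<in> sets borel"
      using E by (simp add: sets_restrict_space_iff)
    show "compact {a. (x, a) \<in> {z \<in> E. u z \<le> ereal l}}" for x
      using compact[of x l] by simp
  qed
  have "{x. sections_inf E u x < c} =
      (\<Union>q\<in>{q::rat. ereal (real_of_rat q) < c}. fst ` {z \<in> E. u z \<le> ereal (real_of_rat q)})" for c
  proof (intro equalityI subsetI)
    fix x assume "x \<in> {x. sections_inf E u x < c}"
    then obtain a where a: "(x, a) \<in> E" "u (x, a) < c"
      by (auto simp: sections_inf_def INF_less_iff)
    obtain q :: rat where "u (x, a) < ereal (real_of_rat q)" "ereal (real_of_rat q) < c"
      using ereal_dense3[OF a(2)] by auto
    with a(1) show "x \<in> (\<Union>q\<in>{q::rat. ereal (real_of_rat q) < c}.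
        fst ` {z \<in> E. u z \<le> ereal (real_of_rat q)})"
      by force
  next
    fix x assume "x \<in> (\<Union>q\<in>{q::rat. ereal (real_of_rat q) < c}.
        fst ` {z \<in> E. u z \<le> ereal (real_of_rat q)})"
    then obtain q :: rat and a where "ereal (real_of_rat q) < c" "(x, a) \<in> E"
      "u (x, a) \<le> ereal (real_of_rat q)"
      by auto
    then show "x \<in> {x. sections_inf E u x < c}"
      by (auto simp: sections_inf_def INF_less_iff intro: le_less_trans)
  qed
  moreover have "(\<Union>q\<in>{q::rat. ereal (real_of_rat q) < c}.
      fst ` {z \<in> E. u z \<le> ereal (real_of_rat q)}) \<in> sets borel" for c
    by (intro sets.countable_UN'' sublevel) auto
  ultimately have "{x. sections_inf E u x < c} \<in> sets borel" for c
    by simp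
  then show ?thesis
    by (intro borel_measurableI_less) simp
qed

text \<open>
  The sublevels at the real levels above the infimum are nested nonempty compact sets, and a
  point common to all of them is a minimizer.
\<close>

lemma sections_inf_attained:
  fixes E :: "('x::topological_space \<times> 'a::t2_space) set"
  assumes "borel_compact_sublevels E u" and finite: "sections_inf E u x < \<infinity>"
  obtains a where "(x, a) \<in> E" "u (x, a) = sections_inf E u x"
proof -
  let ?v = "sections_inf E u x"
  define K where "K q = {a. (x, a) \<in> E \<and> u (x, a) \<le> ereal q}" for q
  have compact: "compact (K q)" for q
    using assms by (auto simp: borel_compact_sublevels_def K_def)
  have nonempty: "K q \<noteq> {}" if "?v < ereal q" for q
    using that by (auto simp: K_def sections_inf_def INF_less_iff intro: less_imp_le)
  obtain q0 where q0: "?v < ereal q0"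
    using ereal_dense2[OF finite] by auto
  have "K q0 \<inter> (\<Inter>q\<in>{q. ?v < ereal q}. K q) \<noteq> {}"
  proof (rule compact_imp_fip_image)
    fix I assume I: "finite I" "I \<subseteq> {q. ?v < ereal q}"
    define q1 where "q1 = Min (insert q0 I)"
    have "q1 \<in> insert q0 I"
      unfolding q1_def using I(1) by (intro Min_in) auto
    then have "?v < ereal q1"
      using I(2) q0 by auto
    then obtain a where a: "a \<in> K q1"
      using nonempty by blast
    have "a \<in> K q" if "q \<in> insert q0 I" for q
    proof -
      have "ereal q1 \<le> ereal q"
        unfolding q1_def using that I(1) by (simp del: Min_insert)
      then show ?thesis using a by (auto simp: K_def intro: order_trans)
    qed
    then show "K q0 \<inter> (\<Inter>q\<in>I. K q) \<noteq> {}"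
      by blast
  qed (auto intro: compact compact_imp_closed)
  then obtain a where a: "a \<in> K q0" "\<And>q. ?v < ereal q \<Longrightarrow> a \<in> K q" by blast
  have "u (x, a) \<le> ?v"
  proof (rule dense_ge)
    fix y assume "?v < y"
    then obtain q where "?v < ereal q" "ereal q < y" using ereal_dense2 by blast
    then show "u (x, a) \<le> y" using a(2)[of q] by (auto simp: K_def intro: order_trans less_imp_le)
  qed
  moreover have "?v \<le> u (x, a)"
    using a(1) by (auto simp: K_def sections_inf_def intro: INF_lower)
  ultimately show ?thesis using that[of a] a(1) by (auto simp: K_def)
qed

lemma minimizers_borel:
  fixes E :: "('x::{complete_space, second_countable_topology} \<times>
      'a::{complete_space, second_countable_topology}) set"
  assumes "borel_compact_sublevels E u"
  shows "minimizers E u \<in> sets borel"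
proof -
  have E: "E \<in> sets borel" and u[measurable]: "u \<in> borel_measurable (restrict_space borel E)"
    using assms by (auto simp: borel_compact_sublevels_def)
  have "(\<lambda>z. sections_inf E u (fst z)) \<in> borel_measurable borel"
    by (rule measurable_compose[OF
          borel_measurable_continuous_onI[OF continuous_on_fst[OF continuous_on_id]]
          measurable_sections_inf[OF assms]])
  then have [measurable]: "(\<lambda>z. sections_inf E u (fst z)) \<in> borel_measurable (restrict_space borel E)"
    by (rule measurable_restrict_space1)
  have "{z \<in> space (restrict_space borel E). u z = sections_inf E u (fst z) \<and>
      sections_inf E u (fst z) < \<infinity>} \<in> sets (restrict_space borel E)"
    by measurable
  then show ?thesis
    using E by (simp add: minimizers_def sets_restrict_space_iff space_restrict_space)
qed

text \<open>
  Where the infimum is finite it is a real number, being an attained value other than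
  \<open>-\<infinity>\<close>, and the minimizers form the sublevel at that level.
\<close>

lemma minimizers_compact:
  fixes E :: "('x::topological_space \<times> 'a::t2_space) set"
  assumes "borel_compact_sublevels E u"
  shows "compact {a. (x, a) \<in> minimizers E u}"
proof (cases "sections_inf E u x < \<infinity>")
  case True
  then obtain a where a: "(x, a) \<in> E" "u (x, a) = sections_inf E u x"
    using sections_inf_attained[OF assms] by metis
  moreover have "u (x, a) \<noteq> -\<infinity>"
    using assms a(1) by (auto simp: borel_compact_sublevels_def)
  ultimately obtain l where l: "sections_inf E u x = ereal l"
    using True by (cases "sections_inf E u x") auto
  have "u (x, b) = sections_inf E u x \<longleftrightarrow> u (x, b) \<le> ereal l" if "(x, b) \<in> E" for b
    using that INF_lower[of b "{a. (x, a) \<in> E}" "\<lambda>a. u (x, a)"] l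
    by (auto simp: sections_inf_def intro: antisym)
  then have "{a. (x, a) \<in> minimizers E u} = {a. (x, a) \<in> E \<and> u (x, a) \<le> ereal l}"
    using True by (auto simp: minimizers_def)
  then show ?thesis
    using assms by (simp add: borel_compact_sublevels_def)
qed (simp add: minimizers_def)

lemma fst_minimizers:
  fixes E :: "('x::topological_space \<times> 'a::t2_space) set"
  assumes "borel_compact_sublevels E u"
  shows "fst ` minimizers E u = {x. sections_inf E u x < \<infinity>}"
proof -
  have "x \<in> fst ` minimizers E u \<longleftrightarrow> sections_inf E u x < \<infinity>" for x
  proof
    assume "sections_inf E u x < \<infinity>"
    moreover from sections_inf_attained[OF assms this]
    obtain a where "(x, a) \<in> E" "u (x, a) = sections_inf E u x" .
    ultimately have "(x, a) \<in> minimizers E u" by (simp add: minimizers_def)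
    then show "x \<in> fst ` minimizers E u" by (metis fst_conv imageI)
  qed (auto simp: minimizers_def)
  then show ?thesis by blast
qed

text \<open>
  Fix a dense sequence \<open>e\<close> and minimize successively the distances to \<open>e 0, e 1, \<dots>\<close>, each
  over the minimizers of the preceding ones. All stages remain Borel with nonempty compact
  sections over the projection of \<open>F\<close>, so in each of them a point survives; it is unique because
  its distances to the dense points are determined. The selected graph \<open>G\<close> is again Borel with compact
  sections, and so the preimage of a closed set \<open>T\<close> under the selector, which is
  the projection of the part of \<open>G\<close> over \<open>T\<close>, is Borel.
\<close>

lemma borel_selection_compact_sections:
  fixes F :: "('x::{complete_space, second_countable_topology} \<times>
      'a::{complete_space, second_countable_topology}) set"
  assumes F: "F \<in> sets borel"
    and compact: "\<And>x. compact {a. (x, a) \<in> F}"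
  obtains \<phi> where "\<phi> \<in> borel_measurable (restrict_space borel (fst ` F))"
    "\<And>x. x \<in> fst ` F \<Longrightarrow> (x, \<phi> x) \<in> F"
proof -
  obtain D :: "'a set" where D: "countable D" "\<And>U. open U \<Longrightarrow> U \<noteq> {} \<Longrightarrow> \<exists>d\<in>D. d \<in> U"
    using countable_dense_setE by blast
  define e where "e = from_nat_into D"
  have e: "\<exists>n. e n \<in> U" if "open U" "U \<noteq> {}" for U
    using D(2)[OF that] from_nat_into_surj[OF D(1)] by (metis e_def)
  define d where "d n z = ereal (dist (snd z) (e n))" for n and z :: "'x \<times> 'a"
  define M where "M = rec_nat F (\<lambda>n E. minimizers E (d n))"
  have M_0: "M 0 = F" and M_Suc: "M (Suc n) = minimizers (M n) (d n)" for n
    by (simp_all add: M_def)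
  have sublevels: "borel_compact_sublevels E (d n)"
    if E: "E \<in> sets borel" and cE: "\<And>x. compact {a. (x, a) \<in> E}" for E n
  proof -
    have "continuous_on UNIV (\<lambda>z::'x \<times> 'a. dist (snd z) (e n))"
      by (intro continuous_intros)
    then have "d n \<in> borel_measurable borel"
      unfolding d_def by (intro borel_measurable_ereal borel_measurable_continuous_onI)
    moreover have "compact {a. (x, a) \<in> E \<and> d n (x, a) \<le> ereal l}" for x l
    proof -
      have "{a. (x, a) \<in> E \<and> d n (x, a) \<le> ereal l} = {a. (x, a) \<in> E} \<inter> cball (e n) l"
        by (auto simp: d_def dist_commute)
      then show ?thesis using cE by (simp add: compact_Int_closed)
    qed
    ultimately show ?thesis
      using E by (auto simp: borel_compact_sublevels_def d_def intro: measurable_restrict_space1)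
  qed
  have M: "M n \<in> sets borel \<and> (\<forall>x. compact {a. (x, a) \<in> M n})" for n
  proof (induction n)
    case 0
    then show ?case using F compact by (simp add: M_0)
  next
    case (Suc n)
    then show ?case
      using sublevels[of "M n" n] minimizers_borel minimizers_compact unfolding M_Suc by blast
  qed
  have fst_M: "fst ` M n = fst ` F" for n
  proof (induction n)
    case (Suc n)
    have "fst ` M (Suc n) = {x. sections_inf (M n) (d n) x < \<infinity>}"
      using M[of n] sublevels unfolding M_Suc by (intro fst_minimizers) auto
    also have "\<dots> = {x. \<exists>a. (x, a) \<in> M n}"
      unfolding sections_inf_def INF_less_iff by (simp add: d_def)
    also have "\<dots> = fst ` M n"
      by (simp add: fst_eq_Domain Domain_unfold)
    finally show ?case using Suc by simp
  qed (simp add: M_0)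
  have decM: "M n \<subseteq> M m" if "m \<le> n" for m n
    using lift_Suc_antimono_le[of M] that by (auto simp: M_Suc minimizers_def)
  define G where "G = (\<Inter>n. M n)"
  have ex: "\<exists>a. (x, a) \<in> G" if "x \<in> fst ` F" for x
  proof -
    have "{a. (x, a) \<in> F} \<inter> (\<Inter>n\<in>UNIV. {a. (x, a) \<in> M n}) \<noteq> {}"
    proof (rule compact_imp_fip_image)
      fix I :: "nat set" assume "finite I"
      then obtain N where N: "\<And>n. n \<in> I \<Longrightarrow> n \<le> N"
        using finite_nat_set_iff_bounded_le by auto
      have "x \<in> fst ` M N" using that by (simp only: fst_M)
      then obtain a where a: "(x, a) \<in> M N" by auto
      have "(x, a) \<in> M n" if "n \<le> N" for n
        using a decM[OF that] by auto
      then have "a \<in> {a. (x, a) \<in> F} \<inter> (\<Inter>n\<in>I. {a. (x, a) \<in> M n})"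
        using N M_0 by auto
      then show "{a. (x, a) \<in> F} \<inter> (\<Inter>n\<in>I. {a. (x, a) \<in> M n}) \<noteq> {}"
        by blast
    qed (use compact M in \<open>auto intro: compact_imp_closed\<close>)
    then show ?thesis by (auto simp: G_def)
  qed
  have unique: "a = b" if "(x, a) \<in> G" "(x, b) \<in> G" for x a b
  proof (rule ccontr)
    assume "a \<noteq> b"
    have eq: "dist a (e n) = dist b (e n)" for n
    proof -
      have "(x, a) \<in> M (Suc n)" "(x, b) \<in> M (Suc n)" using that by (auto simp: G_def)
      then have "d n (x, a) = d n (x, b)" by (simp add: M_Suc minimizers_def)
      then show ?thesis by (simp add: d_def)
    qed
    obtain n where "e n \<in> ball a (dist a b / 2)"
      using e[of "ball a (dist a b / 2)"] \<open>a \<noteq> b\<close> by auto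
    then have "dist a (e n) < dist a b / 2" "dist b (e n) < dist a b / 2"
      using eq[of n] by simp_all
    then show False using dist_triangle2[of a b "e n"] by linarith
  qed
  define \<phi> where "\<phi> x = (SOME a. (x, a) \<in> G)" for x
  have \<phi>: "(x, \<phi> x) \<in> G" if "x \<in> fst ` F" for x
    unfolding \<phi>_def using ex[OF that] by (rule someI_ex)
  have G_sub: "G \<subseteq> F"
    using M_0 by (auto simp: G_def)
  have G: "G \<in> sets borel" "\<And>x. compact {a. (x, a) \<in> G}"
  proof -
    show "G \<in> sets borel" using M by (auto simp: G_def)
    fix x
    have "{a. (x, a) \<in> G} = {a. (x, a) \<in> F} \<inter> (\<Inter>n. {a. (x, a) \<in> M n})"
      using G_sub by (auto simp: G_def)
    moreover have "closed (\<Inter>n. {a. (x, a) \<in> M n})"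
      using M by (intro closed_INT ballI compact_imp_closed) simp
    ultimately show "compact {a. (x, a) \<in> G}"
      using compact by (simp add: compact_Int_closed)
  qed
  have preimage: "\<phi> -` T \<inter> fst ` F \<in> sets borel" if "closed T" for T
  proof -
    have "x \<in> \<phi> -` T \<inter> fst ` F \<longleftrightarrow> x \<in> fst ` (G \<inter> snd -` T)" for x
    proof
      assume "x \<in> \<phi> -` T \<inter> fst ` F"
      then have "(x, \<phi> x) \<in> G \<inter> snd -` T" using \<phi>[of x] by auto
      then show "x \<in> fst ` (G \<inter> snd -` T)" by (metis fst_conv imageI)
    next
      assume "x \<in> fst ` (G \<inter> snd -` T)"
      then obtain a where a: "(x, a) \<in> G" "a \<in> T" by auto
      then have "x \<in> fst ` F" using G_sub by (metis fst_conv imageI subsetD)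
      moreover have "\<phi> x = a" using \<phi>[OF calculation] a(1) by (rule unique)
      ultimately show "x \<in> \<phi> -` T \<inter> fst ` F" using a(2) by simp
    qed
    then have "\<phi> -` T \<inter> fst ` F = fst ` (G \<inter> snd -` T)"
      by blast
    also have "\<dots> \<in> sets borel"
    proof (rule borel_projection_compact_sections)
      show "G \<inter> snd -` T \<in> sets borel"
        using G(1) that by (intro sets.Int borel_vimage_continuous continuous_on_snd continuous_on_id) auto
      have "{a. (x, a) \<in> G \<inter> snd -` T} = {a. (x, a) \<in> G} \<inter> T" for x by auto
      then show "compact {a. (x, a) \<in> G \<inter> snd -` T}" for x
        using G(2) that by (simp add: compact_Int_closed)
    qed
    finally show ?thesis .
  qed
  show ?thesis
  proof (rule that)
    show "\<phi> \<in> borel_measurable (restrict_space borel (fst ` F))"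
    proof (rule borel_measurableI)
      fix T :: "'a set" assume "open T"
      have P: "fst ` F \<in> sets borel"
        using F compact by (rule borel_projection_compact_sections)
      have "\<phi> -` T \<inter> fst ` F = fst ` F - (\<phi> -` (- T) \<inter> fst ` F)" by auto
      also have "\<dots> \<in> sets borel"
        using P preimage[of "- T"] \<open>open T\<close> by (auto simp: closed_Compl)
      finally show "\<phi> -` T \<inter> space (restrict_space borel (fst ` F)) \<in> sets (restrict_space borel (fst ` F))"
        using P by (simp add: sets_restrict_space_iff space_restrict_space)
    qed
  next
    show "(x, \<phi> x) \<in> F" if "x \<in> fst ` F" for x
      using \<phi>[OF that] G_sub by auto
  qed
qed

text \<open>
  Outside \<open>X\<close> the sections of the graph are empty, so the infimum over the section is \<open>\<infinity>\<close>
  there; the domain of the value function is thus a strict sublevel of a function that is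
  Borel on the whole space.
\<close>

theorem theorem2p2:
  fixes X :: "'x::polish_space set"
    and \<AA> :: "'a::polish_space set"
    and A :: "'x \<Rightarrow> 'a set"
    and u :: "'x \<times> 'a \<Rightarrow> ereal"
  assumes X_borel: "X \<in> sets borel"
    and AA_borel: "\<AA> \<in> sets borel"
    and A_values: "\<forall>x\<in>X. A x \<subseteq> \<AA>"
    and A_strict: "strict_on X A"
    and Gr_borel: "Gr X A \<in> sets (borel_on (X \<times> \<AA>))"
    and u_range: "\<forall>z\<in>Gr X A. u z \<noteq> -\<infinity>"
    and u_borel: "u \<in> borel_measurable (borel_on (Gr X A))"
    and u_inf_compact: "\<forall>x\<in>X. inf_compact_on (A x) (\<lambda>a. u (x, a))"
  shows "dom_on X (value_fun A u) \<in> sets (borel_on X)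
    \<and> (\<exists>\<phi> \<in> borel_on (dom_on X (value_fun A u)) \<rightarrow>\<^sub>M borel_on \<AA>.
         \<forall>x\<in>dom_on X (value_fun A u). \<phi> x \<in> A x \<and> u (x, \<phi> x) = value_fun A u x)
    \<and> value_fun A u \<in> borel_measurable (borel_on X)"
proof -
  let ?v = "value_fun A u" and ?D = "dom_on X (value_fun A u)" and ?E = "Gr X A"
  have E: "?E \<in> sets borel"
    using Gr_borel X_borel AA_borel by (simp add: sets_restrict_space_iff borel_Times)
  have "compact {a. (x, a) \<in> ?E \<and> u (x, a) \<le> ereal l}" for x l
  proof (cases "x \<in> X")
    case True
    then show ?thesis using u_inf_compact by (simp add: Gr_def inf_compact_on_def)
  qed (simp add: Gr_def)
  then have sublevels: "borel_compact_sublevels ?E u"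
    using E u_borel u_range by (simp add: borel_compact_sublevels_def)
  have v_eq: "sections_inf ?E u x = ?v x" if "x \<in> X" for x
    using that by (simp add: sections_inf_def value_fun_def Gr_def)
  have v_out: "sections_inf ?E u x = \<infinity>" if "x \<notin> X" for x
    using that by (simp add: sections_inf_def Gr_def top_ereal_def)
  have dom: "?D = {x. sections_inf ?E u x < \<infinity>}"
    using v_eq v_out by (force simp: dom_on_def)
  have "sections_inf ?E u \<in> borel_measurable (borel_on X)"
    using measurable_sections_inf[OF sublevels] by (rule measurable_restrict_space1)
  then have v: "?v \<in> borel_measurable (borel_on X)"
    by (rule measurable_cong[THEN iffD1, rotated]) (simp add: v_eq space_restrict_space)
  have "{x. sections_inf ?E u x < \<infinity>} \<in> sets borel"
    using measurable_sets_borel[OF measurable_sections_inf[OF sublevels], of "{..<\<infinity>}"]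
    by (simp add: vimage_def)
  then have D: "?D \<in> sets borel" by (simp add: dom)
  have "?D \<in> sets (borel_on X)"
    using D X_borel by (auto simp: sets_restrict_space_iff dom_on_def)
  have fst_min: "fst ` minimizers ?E u = ?D"
    unfolding dom by (rule fst_minimizers[OF sublevels])
  obtain \<phi> where \<phi>: "\<phi> \<in> borel_measurable (borel_on ?D)"
    "\<And>x. x \<in> ?D \<Longrightarrow> (x, \<phi> x) \<in> minimizers ?E u"
    using borel_selection_compact_sections[OF minimizers_borel[OF sublevels]
        minimizers_compact[OF sublevels]]
    unfolding fst_min by blast
  have sel: "\<phi> x \<in> A x \<and> u (x, \<phi> x) = ?v x" if "x \<in> ?D" for x
    using \<phi>(2)[OF that] v_eq by (auto simp: minimizers_def Gr_def)
  have "\<phi> \<in> borel_on ?D \<rightarrow>\<^sub>M borel_on \<AA>"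
  proof (rule measurable_restrict_space2)
    show "\<phi> \<in> space (borel_on ?D) \<rightarrow> \<AA>"
      using sel A_values by (auto simp: space_restrict_space dom_on_def)
  qed (rule \<phi>(1))
  with sel v \<open>?D \<in> sets (borel_on X)\<close> show ?thesis by blast
qed

end
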